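(* (i) Let $t\ge2$, $\mu\in\mathbb R$, $\sigma^2>0$ and $-\frac1{t-1}<\rho<1$. The multivariate Gaussian prior on the log-strengths $\lambda=(\lambda_1,\dots,\lambda_t)$ with all means equal to $\mu$, all variances equal to $\sigma^2$ and all cross-covariances ($i\ne j$) equal to $\rho\sigma^2$ is equivalent to the product of independent Gaussian distributions on the $\lambda_i$ with mean $0$ and variance $(1-\rho)\sigma^2$. (ii) For any fixed $\sigma^2>0$, the family of priors (for each number of teams $t\ge 2$) $$f_\Lambda(\lambda|I_{\mathrm G})=\frac1{(2\pi\sigma^2)^{t/2}}\exp\left(-\sum_{i=1}^t\frac{\lambda_i^2}{2\sigma^2}\right)$$ satisfies all four desiderata: invariance under interchange of teams, invariance under interchange of winning and losing, normalizability, and invariance under elimination of teams.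
   Context: Bradley-Terry model: $t$ teams have strengths $\pi_1,\dots,\pi_t\in(0,\infty)$ and log-strengths $\lambda_i=\ln\pi_i$; $\gamma_{ij}=\lambda_i-\lambda_j$. (In the displayed Gaussian density, $\pi$ in $2\pi\sigma^2$ is the usual constant.) Let $\gamma=(\gamma_{1t},\dots,\gamma_{(t-1)t})\in\mathbb R^{t-1}$ (any other linear basis of the differences may be used). A prior on the log-strengths (equivalently, on the strengths) induces a density $f_\Gamma(\gamma|I)$ of $\gamma$. Two priors are equivalent ($\cong$) if their induced densities $f_\Gamma$ are equal (almost everywhere). Desiderata: 1. Invariance under interchange of teams: for any $i\ne j$, the transformation exchanging $\lambda_i$ and $\lambda_j$ and fixing all other $\lambda_k$ transforms the prior into an equivalent one. 2. Invariance under interchange of winning and losing: the transformation $\pi_i\to1/\pi_i$ for all $i$ (i.e. $\lambda\to-\lambda$) transforms the prior into an equivalent one; equivalently $f_\Gamma(\gamma|I)=f_\Gamma(-\gamma|I)$. 3. Normalizability: $f_\Gamma$ is a proper prior, i.e. can be normalized to $\int_{\mathbb R^{t-1}}f_\Gamma(\gamma|I)\,d^{t-1}\gamma=1$. 4. Invariance under elimination of teams (for a family of priors, one for each number of teams): for every $t>2$, the prior for $t-1$ teams is equivalent to the marginal distribution of the first $t-1$ strengths under the prior for $t$ teams. *)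

theory Defs
  imports
    "HOL-Probability.Probability"
    "Jordan_Normal_Form.Gauss_Jordan_Elimination"
    "Jordan_Normal_Form.Determinant"
begin

(* The teams are 0, ..., t - 1.  A vector of log-strengths is an extensional function on {..<t},
   so that the number of teams can vary within a statement.  A prior, given on the log-strengths,
   is a measure on this space; it need not be finite (improper priors are allowed). *)
definition logstrength_space :: "nat \<Rightarrow> (nat \<Rightarrow> real) measure" where
  "logstrength_space t = (\<Pi>\<^sub>M i\<in>{..<t}. lborel)"

(* The space of gamma, with one coordinate for every team but the last one. *)
definition gamma_space :: "nat \<Rightarrow> (nat \<Rightarrow> real) measure" where
  "gamma_space t = (\<Pi>\<^sub>M i\<in>{..<t - 1}. lborel)"

definition gamma_of :: "nat \<Rightarrow> (nat \<Rightarrow> real) \<Rightarrow> nat \<Rightarrow> real" where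
  "gamma_of t l = (\<lambda>i\<in>{..<t - 1}. l i - l (t - 1))"

definition induced_density ::
    "nat \<Rightarrow> (nat \<Rightarrow> real) measure \<Rightarrow> ((nat \<Rightarrow> real) \<Rightarrow> ennreal) \<Rightarrow> bool" where
  "induced_density t P f \<longleftrightarrow> distributed P (gamma_space t) (gamma_of t) f"

(* A density of gamma is unique up to a null set, so asking for some pair of densities is the same
   as asking for every pair, except that equivalence here includes that both densities exist. *)
definition prior_equiv :: "nat \<Rightarrow> (nat \<Rightarrow> real) measure \<Rightarrow> (nat \<Rightarrow> real) measure \<Rightarrow> bool" where
  "prior_equiv t P Q \<longleftrightarrow>
    (\<exists>f g. induced_density t P f \<and> induced_density t Q g \<and> (AE \<gamma> in gamma_space t. f \<gamma> = g \<gamma>))"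

definition swap_teams :: "nat \<Rightarrow> nat \<Rightarrow> (nat \<Rightarrow> real) \<Rightarrow> nat \<Rightarrow> real" where
  "swap_teams i j l = l(i := l j, j := l i)"

(* The map pi_i -> 1 / pi_i on strengths, written on log-strengths. *)
definition invert_strengths :: "nat \<Rightarrow> (nat \<Rightarrow> real) \<Rightarrow> nat \<Rightarrow> real" where
  "invert_strengths t l = (\<lambda>i\<in>{..<t}. - l i)"

definition team_interchange_invariant :: "nat \<Rightarrow> (nat \<Rightarrow> real) measure \<Rightarrow> bool" where
  "team_interchange_invariant t P \<longleftrightarrow>
    (\<forall>i<t. \<forall>j<t. i \<noteq> j \<longrightarrow> prior_equiv t (distr P (logstrength_space t) (swap_teams i j)) P)"

definition win_loss_invariant :: "nat \<Rightarrow> (nat \<Rightarrow> real) measure \<Rightarrow> bool" where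
  "win_loss_invariant t P \<longleftrightarrow>
    prior_equiv t (distr P (logstrength_space t) (invert_strengths t)) P"

definition normalizable :: "nat \<Rightarrow> (nat \<Rightarrow> real) measure \<Rightarrow> bool" where
  "normalizable t P \<longleftrightarrow>
    (\<exists>f. induced_density t P f \<and>
      (\<exists>c>0. (\<integral>\<^sup>+ \<gamma>. ennreal c * f \<gamma> \<partial>gamma_space t) = 1))"

definition team_elimination_invariant :: "(nat \<Rightarrow> (nat \<Rightarrow> real) measure) \<Rightarrow> bool" where
  "team_elimination_invariant P \<longleftrightarrow>
    (\<forall>t>2. prior_equiv (t - 1) (P (t - 1))
      (distr (P t) (logstrength_space (t - 1)) (\<lambda>l. restrict l {..<t - 1})))"

(* Density of the n-variate Gaussian with mean vector m and covariance matrix S, for a positive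
   definite n x n matrix S; only for singular S is mat_inverse S equal to None. *)
definition multivariate_normal_density ::
    "nat \<Rightarrow> (nat \<Rightarrow> real) \<Rightarrow> real mat \<Rightarrow> (nat \<Rightarrow> real) \<Rightarrow> real" where
  "multivariate_normal_density n m S x =
    exp (- (\<Sum>i<n. \<Sum>j<n. (x i - m i) * the (mat_inverse S) $$ (i, j) * (x j - m j)) / 2)
      / sqrt ((2 * pi) ^ n * Determinant.det S)"

definition exchangeable_cov :: "nat \<Rightarrow> real \<Rightarrow> real \<Rightarrow> real mat" where
  "exchangeable_cov t \<sigma> \<rho> = Matrix.mat t t (\<lambda>(i, j). if i = j then \<sigma>\<^sup>2 else \<rho> * \<sigma>\<^sup>2)"

definition exchangeable_gaussian_prior ::
    "nat \<Rightarrow> real \<Rightarrow> real \<Rightarrow> real \<Rightarrow> (nat \<Rightarrow> real) measure" where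
  "exchangeable_gaussian_prior t \<mu> \<sigma> \<rho> =
    density (logstrength_space t)
      (\<lambda>l. ennreal (multivariate_normal_density t (\<lambda>_. \<mu>) (exchangeable_cov t \<sigma> \<rho>) l))"

(* Product of t independent Gaussians with mean 0 and standard deviation s. *)
definition independent_gaussian_prior :: "nat \<Rightarrow> real \<Rightarrow> (nat \<Rightarrow> real) measure" where
  "independent_gaussian_prior t s =
    (\<Pi>\<^sub>M i\<in>{..<t}. density lborel (\<lambda>x. ennreal (normal_density 0 s x)))"

definition gaussian_prior :: "real \<Rightarrow> nat \<Rightarrow> (nat \<Rightarrow> real) measure" where
  "gaussian_prior \<sigma> t =
    density (logstrength_space t)
      (\<lambda>l. ennreal (1 / (2 * pi * \<sigma>\<^sup>2) powr (real t / 2)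
                    * exp (- (\<Sum>i<t. (l i)\<^sup>2 / (2 * \<sigma>\<^sup>2)))))"

end

theory Submission
  imports Defs
begin

text \<open>With \<open>s\<^sup>2 = (1 - \<rho>) \<sigma>\<^sup>2\<close> and \<open>\<kappa> = \<rho> / (1 + (t - 1) \<rho>)\<close>, the exchangeable Gaussian has the
  exponent \<open>- (\<Sum> y\<^sub>i\<^sup>2 - \<kappa> (\<Sum> y\<^sub>i)\<^sup>2) / (2 s\<^sup>2)\<close>, where \<open>y\<^sub>i = \<lambda>\<^sub>i - \<mu>\<close>. Integrating out the last
  log-strength for fixed \<open>\<gamma>\<close> gives a density of \<open>\<gamma>\<close> in which neither \<open>\<mu>\<close> nor \<open>\<kappa>\<close> remains, so that
  \<open>\<mu> = \<kappa> = 0\<close>, the independent prior, gives the same one. The independent prior with a common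
  variance is itself preserved by swaps, by reflection, and by forgetting a coordinate.\<close>

section \<open>Finite products of measures: componentwise maps and densities\<close>

text \<open>A finite product of sigma-finite measures is determined by its values on boxes, and the
  preimage of a box under a componentwise map is again a box. Serves for translations of Lebesgue
  measure and for the reflection of Gaussians.\<close>

lemma distr_PiM_componentwise:
  fixes M :: "'i \<Rightarrow> 'a measure"
  assumes fin: "finite I"
    and sf: "\<And>i. sigma_finite_measure (M i)"
    and g: "\<And>i. i \<in> I \<Longrightarrow> g i \<in> measurable (M i) (M i)"
    and inv: "\<And>i. i \<in> I \<Longrightarrow> distr (M i) (M i) (g i) = M i"
  shows "distr (Pi\<^sub>M I M) (Pi\<^sub>M I M) (\<lambda>x. \<lambda>i\<in>I. g i (x i)) = Pi\<^sub>M I M"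
proof -
  interpret product_sigma_finite M
    using sf by (simp add: product_sigma_finite_def)
  have meas: "(\<lambda>x. \<lambda>i\<in>I. g i (x i)) \<in> measurable (Pi\<^sub>M I M) (Pi\<^sub>M I M)"
    by (intro measurable_restrict) (rule measurable_compose[OF measurable_component_singleton], auto intro: g)
  show ?thesis
  proof (rule PiM_eqI)
    fix A assume A: "\<And>i. i \<in> I \<Longrightarrow> A i \<in> sets (M i)"
    have pre: "(\<lambda>x. \<lambda>i\<in>I. g i (x i)) -` Pi\<^sub>E I A \<inter> space (Pi\<^sub>M I M) = Pi\<^sub>E I (\<lambda>i. g i -` A i \<inter> space (M i))"
      by (auto simp: space_PiM PiE_iff)
    have "emeasure (distr (Pi\<^sub>M I M) (Pi\<^sub>M I M) (\<lambda>x. \<lambda>i\<in>I. g i (x i))) (Pi\<^sub>E I A)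
        = emeasure (Pi\<^sub>M I M) (Pi\<^sub>E I (\<lambda>i. g i -` A i \<inter> space (M i)))"
      using A fin meas by (subst emeasure_distr) (auto simp: pre intro!: sets_PiM_I_finite)
    also have "\<dots> = (\<Prod>i\<in>I. emeasure (M i) (g i -` A i \<inter> space (M i)))"
      using fin A g by (intro emeasure_PiM) (auto intro: measurable_sets)
    also have "\<dots> = (\<Prod>i\<in>I. emeasure (M i) (A i))"
    proof (rule prod.cong)
      fix i assume i: "i \<in> I"
      have "emeasure (M i) (g i -` A i \<inter> space (M i)) = emeasure (distr (M i) (M i) (g i)) (A i)"
        using i A g by (simp add: emeasure_distr)
      then show "emeasure (M i) (g i -` A i \<inter> space (M i)) = emeasure (M i) (A i)"
        using inv[OF i] by simp
    qed simp
    finally show "emeasure (distr (Pi\<^sub>M I M) (Pi\<^sub>M I M) (\<lambda>x. \<lambda>i\<in>I. g i (x i))) (Pi\<^sub>E I A)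
        = (\<Prod>i\<in>I. emeasure (M i) (A i))" .
  qed (use fin in simp_all)
qed

text \<open>The indicator of a box factorizes, so the integral over a box splits into
  one-dimensional integrals. Sigma-finiteness of the \<open>density (M i) (f i)\<close> makes values
  on boxes determine their product.\<close>

lemma PiM_density:
  fixes M :: "'i \<Rightarrow> 'a measure"
  assumes fin: "finite I"
    and sf: "\<And>i. sigma_finite_measure (M i)"
    and f: "\<And>i. f i \<in> borel_measurable (M i)"
    and sfd: "\<And>i. sigma_finite_measure (density (M i) (f i))"
  shows "Pi\<^sub>M I (\<lambda>i. density (M i) (f i)) = density (Pi\<^sub>M I M) (\<lambda>x. \<Prod>i\<in>I. f i (x i))"
proof -
  interpret M: product_sigma_finite M
    using sf by (simp add: product_sigma_finite_def)
  interpret D: product_sigma_finite "\<lambda>i. density (M i) (f i)"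
    using sfd by (simp add: product_sigma_finite_def)
  note [measurable] = f
  show ?thesis
  proof (rule D.PiM_eqI[symmetric])
    show "sets (density (Pi\<^sub>M I M) (\<lambda>x. \<Prod>i\<in>I. f i (x i))) = sets (Pi\<^sub>M I (\<lambda>i. density (M i) (f i)))"
      by (simp cong: sets_PiM_cong)
    fix A assume A: "\<And>i. i \<in> I \<Longrightarrow> A i \<in> sets (density (M i) (f i))"
    have [measurable]: "Pi\<^sub>E I A \<in> sets (Pi\<^sub>M I M)"
      using A fin by (auto intro!: sets_PiM_I_finite)
    have "emeasure (density (Pi\<^sub>M I M) (\<lambda>x. \<Prod>i\<in>I. f i (x i))) (Pi\<^sub>E I A)
        = (\<integral>\<^sup>+x. (\<Prod>i\<in>I. f i (x i)) * indicator (Pi\<^sub>E I A) x \<partial>Pi\<^sub>M I M)"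
      by (rule emeasure_density) measurable
    also have "\<dots> = (\<integral>\<^sup>+x. (\<Prod>i\<in>I. f i (x i) * indicator (A i) (x i)) \<partial>Pi\<^sub>M I M)"
    proof (rule nn_integral_cong)
      fix x assume "x \<in> space (Pi\<^sub>M I M)"
      then have "indicator (Pi\<^sub>E I A) x = (\<Prod>i\<in>I. indicator (A i) (x i) :: ennreal)"
        using fin by (auto simp: space_PiM PiE_iff indicator_def prod_zero_iff split: if_splits)
      then show "(\<Prod>i\<in>I. f i (x i)) * indicator (Pi\<^sub>E I A) x
          = (\<Prod>i\<in>I. f i (x i) * indicator (A i) (x i))"
        by (simp add: prod.distrib)
    qed
    also have "\<dots> = (\<Prod>i\<in>I. \<integral>\<^sup>+x. f i x * indicator (A i) x \<partial>M i)"
      using A by (intro M.product_nn_integral_prod fin) auto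
    also have "\<dots> = (\<Prod>i\<in>I. emeasure (density (M i) (f i)) (A i))"
      using A by (intro prod.cong) (auto simp: emeasure_density)
    finally show "emeasure (density (Pi\<^sub>M I M) (\<lambda>x. \<Prod>i\<in>I. f i (x i))) (Pi\<^sub>E I A)
        = (\<Prod>i\<in>I. emeasure (density (M i) (f i)) (A i))" .
  qed (rule fin)
qed

section \<open>Change of variables from log-strengths to differences\<close>

lemma distr_PiM_lborel_translate:
  fixes c :: real
  assumes "finite I"
  shows "distr (\<Pi>\<^sub>M i\<in>I. lborel) (\<Pi>\<^sub>M i\<in>I. lborel) (\<lambda>x. \<lambda>i\<in>I. c + x i) = (\<Pi>\<^sub>M i\<in>I. lborel)"
proof (rule distr_PiM_componentwise[OF assms])
  show "distr lborel lborel ((+) c) = lborel"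
    using lborel_distr_plus[of c] by (simp cong: distr_cong)
qed (auto intro: sigma_finite_lborel)

text \<open>Write a vector of log-strengths as \<open>(\<gamma> + u, u)\<close>, where \<open>u\<close> is the last
  log-strength; this change of variables is a translation for every fixed \<open>u\<close>.\<close>

lemma induced_density_density:
  fixes h :: "(nat \<Rightarrow> real) \<Rightarrow> ennreal"
  assumes h: "h \<in> borel_measurable (logstrength_space (Suc n))"
  shows "induced_density (Suc n) (density (logstrength_space (Suc n)) h)
    (\<lambda>\<gamma>. \<integral>\<^sup>+u. h ((\<lambda>i\<in>{..<n}. u + \<gamma> i)(n := u)) \<partial>lborel)"
proof -
  interpret product_sigma_finite "\<lambda>_::nat. lborel :: real measure"
    by standard
  let ?P = "\<Pi>\<^sub>M i\<in>{..<n}. lborel :: real measure"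
  let ?Q = "\<Pi>\<^sub>M i\<in>insert n {..<n}. lborel :: real measure"
  interpret P: sigma_finite_measure ?P
    by (rule sigma_finite) simp
  interpret pair_sigma_finite ?P "lborel :: real measure" ..
  let ?k = "\<lambda>\<gamma> u. (\<lambda>i\<in>{..<n}. u + \<gamma> i)(n := u)"
  have L: "logstrength_space (Suc n) = ?Q" and G: "gamma_space (Suc n) = ?P"
    by (simp_all add: logstrength_space_def gamma_space_def lessThan_Suc)
  note hQ[measurable] = h[unfolded L]
  have gm[measurable]: "gamma_of (Suc n) \<in> measurable ?Q ?P"
    unfolding gamma_of_def by (auto intro!: measurable_restrict)
  have km[measurable]: "(\<lambda>(\<gamma>, u). ?k \<gamma> u) \<in> measurable (?P \<Otimes>\<^sub>M lborel) ?Q"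
    unfolding split_beta' fun_upd_def restrict_def by (rule measurable_PiM_single') (auto simp: space_pair_measure PiE_iff extensional_def)
  have tm[measurable]: "(\<lambda>x. \<lambda>i\<in>{..<n}. u + x i) \<in> measurable ?P ?P" for u :: real
    by (auto intro!: measurable_restrict)
  have hk[measurable]: "(\<lambda>(\<gamma>, u). h (?k \<gamma> u)) \<in> borel_measurable (?P \<Otimes>\<^sub>M lborel)"
    using measurable_compose[OF km hQ] by (simp add: split_beta')
  have dm: "(\<lambda>\<gamma>. \<integral>\<^sup>+u. h (?k \<gamma> u) \<partial>lborel) \<in> borel_measurable ?P"
    by measurable
  have "distr (density ?Q h) ?P (gamma_of (Suc n)) = density ?P (\<lambda>\<gamma>. \<integral>\<^sup>+u. h (?k \<gamma> u) \<partial>lborel)"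
  proof (rule measure_eqI)
    fix A assume "A \<in> sets (distr (density ?Q h) ?P (gamma_of (Suc n)))"
    then have A[measurable]: "A \<in> sets ?P" by simp
    have upd: "x(n := u) \<in> space ?Q" if "x \<in> space ?P" for x :: "nat \<Rightarrow> real" and u
      using that by (auto simp: space_PiM PiE_iff extensional_def)
    have m1: "(\<lambda>l. h l * indicator A (gamma_of (Suc n) l)) \<in> borel_measurable ?Q"
      by measurable
    have "emeasure (distr (density ?Q h) ?P (gamma_of (Suc n))) A
        = (\<integral>\<^sup>+l. h l * indicator (gamma_of (Suc n) -` A \<inter> space ?Q) l \<partial>?Q)"
      by (simp add: emeasure_distr emeasure_density)
    also have "\<dots> = (\<integral>\<^sup>+l. h l * indicator A (gamma_of (Suc n) l) \<partial>?Q)"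
      by (intro nn_integral_cong) (auto simp: indicator_def)
    \<comment> \<open>The last coordinate goes outermost: with \<open>u\<close> fixed, the
      substitution in the inner integral is a translation, which preserves Lebesgue measure.\<close>
    also have "\<dots> = (\<integral>\<^sup>+u. \<integral>\<^sup>+x. h (x(n := u)) * indicator A (gamma_of (Suc n) (x(n := u))) \<partial>?P \<partial>lborel)"
      by (rule product_nn_integral_insert_rev[OF _ _ m1]) simp_all
    also have "\<dots> = (\<integral>\<^sup>+u. \<integral>\<^sup>+\<gamma>. h (?k \<gamma> u) * indicator A \<gamma> \<partial>?P \<partial>lborel)"
    proof (rule nn_integral_cong)
      fix u :: real
      let ?T = "\<lambda>x. \<lambda>i\<in>{..<n}. u + x i"
      have um: "(\<lambda>x. x(n := u)) \<in> measurable ?P ?Q"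
        by (rule measurable_fun_upd[where J = "{..<n}"]) auto
      have m2: "(\<lambda>x. h (x(n := u)) * indicator A (gamma_of (Suc n) (x(n := u)))) \<in> borel_measurable ?P"
        using measurable_compose[OF um m1] .
      have "(\<integral>\<^sup>+x. h (x(n := u)) * indicator A (gamma_of (Suc n) (x(n := u))) \<partial>?P)
          = (\<integral>\<^sup>+x. h (x(n := u)) * indicator A (gamma_of (Suc n) (x(n := u))) \<partial>distr ?P ?P ?T)"
        by (subst distr_PiM_lborel_translate) simp_all
      also have "\<dots> = (\<integral>\<^sup>+\<gamma>. h ((?T \<gamma>)(n := u)) * indicator A (gamma_of (Suc n) ((?T \<gamma>)(n := u))) \<partial>?P)"
        by (rule nn_integral_distr[OF tm]) (use m2 in simp)
      also have "\<dots> = (\<integral>\<^sup>+\<gamma>. h (?k \<gamma> u) * indicator A \<gamma> \<partial>?P)"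
      proof (rule nn_integral_cong)
        fix \<gamma> assume "\<gamma> \<in> space ?P"
        then have "gamma_of (Suc n) ((?T \<gamma>)(n := u)) = \<gamma>"
          by (auto simp: gamma_of_def fun_eq_iff restrict_def space_PiM PiE_iff extensional_def)
        then show "h ((?T \<gamma>)(n := u)) * indicator A (gamma_of (Suc n) ((?T \<gamma>)(n := u)))
            = h (?k \<gamma> u) * indicator A \<gamma>"
          by simp
      qed
      finally show "(\<integral>\<^sup>+x. h (x(n := u)) * indicator A (gamma_of (Suc n) (x(n := u))) \<partial>?P)
          = (\<integral>\<^sup>+\<gamma>. h (?k \<gamma> u) * indicator A \<gamma> \<partial>?P)" .
    qed
    \<comment> \<open>With \<open>u\<close> innermost, \<open>indicator A \<gamma>\<close> is
      constant in the inner integral and can be pulled out, leaving the claimed density.\<close>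
    also have "\<dots> = (\<integral>\<^sup>+\<gamma>. \<integral>\<^sup>+u. h (?k \<gamma> u) * indicator A \<gamma> \<partial>lborel \<partial>?P)"
      by (rule Fubini') measurable
    also have "\<dots> = (\<integral>\<^sup>+\<gamma>. (\<integral>\<^sup>+u. h (?k \<gamma> u) \<partial>lborel) * indicator A \<gamma> \<partial>?P)"
      by (intro nn_integral_cong nn_integral_multc) measurable
    also have "\<dots> = emeasure (density ?P (\<lambda>\<gamma>. \<integral>\<^sup>+u. h (?k \<gamma> u) \<partial>lborel)) A"
      by (rule emeasure_density[symmetric]) (use dm A in auto)
    finally show "emeasure (distr (density ?Q h) ?P (gamma_of (Suc n))) A
        = emeasure (density ?P (\<lambda>\<gamma>. \<integral>\<^sup>+u. h (?k \<gamma> u) \<partial>lborel)) A" .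
  qed simp
  then show ?thesis
    unfolding induced_density_def distributed_def L G using dm gm by simp
qed

section \<open>Inverse and determinant of a multiple of the identity plus a constant matrix\<close>

text \<open>Allows the inverse of the covariance matrix to be guessed and verified:
  \<open>None\<close> is excluded because \<open>A\<close> is a unit, and a result
  \<open>Some C\<close> must agree with \<open>B\<close> by uniqueness of inverses.\<close>

lemma mat_inverse_unique:
  fixes A B :: "'a::field mat"
  assumes A: "A \<in> carrier_mat n n" and B: "B \<in> carrier_mat n n"
    and AB: "A * B = 1\<^sub>m n" and BA: "B * A = 1\<^sub>m n"
  shows "mat_inverse A = Some B"
proof (cases "mat_inverse A")
  case None
  have "A \<in> Units (ring_mat TYPE('a) n ())"
    using assms by (auto simp: Units_def ring_mat_simps)
  with mat_inverse(1)[OF A None, of "()"] show ?thesis by simp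
next
  case (Some C)
  then have C: "C \<in> carrier_mat n n" "C * A = 1\<^sub>m n"
    using mat_inverse(2)[OF A Some] by auto
  have "C = C * (A * B)" using C AB by simp
  also have "\<dots> = (C * A) * B" by (rule assoc_mult_mat[OF C(1) A B, symmetric])
  also have "\<dots> = B" using C B by simp
  finally show ?thesis using Some by simp
qed

text \<open>This is \<open>a I + b J\<close>, with \<open>I\<close> the identity and
  \<open>J\<close> the all-ones matrix.\<close>

definition scalar_plus_const_mat :: "nat \<Rightarrow> 'a \<Rightarrow> 'a \<Rightarrow> 'a::comm_ring_1 mat" where
  "scalar_plus_const_mat n a b = Matrix.mat n n (\<lambda>(i, j). (if i = j then a else 0) + b)"

lemma scalar_plus_const_mat_carrier [simp]:
  "scalar_plus_const_mat n a b \<in> carrier_mat n n"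
  by (simp add: scalar_plus_const_mat_def)

text \<open>Follows from \<open>J * J = n J\<close>. The family is closed under products, so an
  inverse can be sought within it.\<close>

lemma scalar_plus_const_mat_mult:
  "scalar_plus_const_mat n a b * scalar_plus_const_mat n c d
    = scalar_plus_const_mat n (a * c) (a * d + b * c + of_nat n * b * d)"
  (is "?L = ?R")
proof (rule eq_matI)
  fix i j assume "i < dim_row ?R" "j < dim_col ?R"
  then have ij: "i < n" "j < n"
    by (simp_all add: scalar_plus_const_mat_def)
  have "?L $$ (i, j) = (\<Sum>k<n. ((if i = k then a else 0) + b) * ((if k = j then c else 0) + d))"
    using ij by (simp add: scalar_plus_const_mat_def scalar_prod_def lessThan_atLeast0)
  also have "\<dots> = (\<Sum>k<n. (if k = i then a * (if i = j then c else 0) else 0)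
      + (if k = i then a * d else 0) + (if k = j then b * c else 0) + b * d)"
    by (intro sum.cong) (auto simp: algebra_simps)
  also have "\<dots> = (if i = j then a * c else 0) + (a * d + b * c + of_nat n * b * d)"
    using ij by (simp add: sum.distrib algebra_simps)
  finally show "?L $$ (i, j) = ?R $$ (i, j)"
    using ij by (simp add: scalar_plus_const_mat_def)
qed (simp_all add: scalar_plus_const_mat_def)

text \<open>The all-ones vector is an eigenvector, with the common row sum as eigenvalue. In the
  basis of the first \<open>n\<close> unit vectors and this vector, which are the columns of
  \<open>?F\<close>, the matrix becomes the lower triangular \<open>?T\<close>.\<close>

lemma det_scalar_plus_const_mat:
  fixes a b :: "'a::idom"
  shows "Determinant.det (scalar_plus_const_mat (Suc n) a b) = a ^ n * (a + of_nat (Suc n) * b)"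
proof -
  \<comment> \<open>Right multiplication by \<open>?F\<close> adds all columns to the last one.\<close>
  let ?A = "scalar_plus_const_mat (Suc n) a b"
  let ?F = "Matrix.mat (Suc n) (Suc n) (\<lambda>(i, j). if i = j \<or> j = n then 1 else 0 :: 'a)"
  let ?T = "Matrix.mat (Suc n) (Suc n)
    (\<lambda>(i, j). (if i < n then (if i = j then a else 0) else if j = n then a + of_nat (Suc n) * b else b))"
  have AF: "?A * ?F = ?F * ?T"
  proof (rule eq_matI)
    fix i j assume "i < dim_row (?F * ?T)" "j < dim_col (?F * ?T)"
    then have ij: "i < Suc n" "j < Suc n" by simp_all
    have "(?A * ?F) $$ (i, j) = (\<Sum>k<Suc n. ((if i = k then a else 0) + b) * (if k = j \<or> j = n then 1 else 0))"
      using ij by (auto simp: scalar_plus_const_mat_def scalar_prod_def lessThan_atLeast0 simp del: sum.op_ivl_Suc intro!: sum.cong)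
    also have "\<dots> = (if j = n then a + of_nat (Suc n) * b else (if i = j then a else 0) + b)"
      using ij by (auto simp: sum.distrib sum.delta less_Suc_eq if_distrib[of "\<lambda>x. _ * x"] simp del: sum.lessThan_Suc cong: if_cong)
    also have "\<dots> = (\<Sum>k<Suc n. (if i = k \<or> k = n then 1 else 0) *
        (if k < n then (if k = j then a else 0) else if j = n then a + of_nat (Suc n) * b else b))"
      using ij by (auto simp: less_Suc_eq if_distrib[of "\<lambda>x. x * _"] cong: if_cong)
    also have "\<dots> = (?F * ?T) $$ (i, j)"
      using ij by (auto simp: scalar_prod_def lessThan_atLeast0 simp del: sum.op_ivl_Suc intro!: sum.cong)
    finally show "(?A * ?F) $$ (i, j) = (?F * ?T) $$ (i, j)" .
  qed (simp_all add: scalar_plus_const_mat_def)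
  have F: "Determinant.det ?F = 1"
    by (subst det_upper_triangular[where n = "Suc n"])
       (auto simp: upper_triangular_def prod_list_diag_prod simp del: prod.op_ivl_Suc)
  have "Determinant.det ?T = prod_list (diag_mat ?T)"
    by (rule det_lower_triangular[where n = "Suc n"]) auto
  also have "\<dots> = (\<Prod>i<Suc n. if i < n then a else a + of_nat (Suc n) * b)"
    by (auto simp: prod_list_diag_prod lessThan_atLeast0 simp del: prod.op_ivl_Suc intro!: prod.cong)
  also have "\<dots> = a ^ n * (a + of_nat (Suc n) * b)"
    by simp
  finally have T: "Determinant.det ?T = a ^ n * (a + of_nat (Suc n) * b)" .
  have "Determinant.det (?A * ?F) = Determinant.det (?F * ?T)" by (simp add: AF)
  then show ?thesis
    using F T by (simp add: det_mult[where n = "Suc n"])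
qed

section \<open>The density of the differences under an exchangeable Gaussian\<close>

text \<open>Given \<open>\<gamma>\<close>, the quadratic form in the last log-strength \<open>u\<close>
  is a square plus a remainder free of \<open>\<mu>\<close> and \<open>\<kappa>\<close>.\<close>

lemma complete_square_last_strength:
  fixes n :: nat and \<gamma> :: "nat \<Rightarrow> real" and u \<mu> \<kappa> :: real
  defines "G \<equiv> \<Sum>i<n. \<gamma> i" and "N \<equiv> real (Suc n)"
  shows "(\<Sum>i<Suc n. (((\<lambda>i\<in>{..<n}. u + \<gamma> i)(n := u)) i - \<mu>)\<^sup>2)
      - \<kappa> * (\<Sum>i<Suc n. ((\<lambda>i\<in>{..<n}. u + \<gamma> i)(n := u)) i - \<mu>)\<^sup>2
    = ((\<Sum>i<n. (\<gamma> i)\<^sup>2) - G\<^sup>2 / N) + N * (1 - \<kappa> * N) * (u - (\<mu> - G / N))\<^sup>2"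
proof -
  define v where "v = u - \<mu>"
  have N: "N \<noteq> 0" "N = real n + 1" by (simp_all add: N_def)
  have "(\<Sum>i<Suc n. ((\<lambda>i\<in>{..<n}. u + \<gamma> i)(n := u)) i - \<mu>) = (\<Sum>i<n. \<gamma> i + v) + v"
    by (simp add: v_def algebra_simps)
  then have S1: "(\<Sum>i<Suc n. ((\<lambda>i\<in>{..<n}. u + \<gamma> i)(n := u)) i - \<mu>) = G + N * v"
    by (simp add: sum.distrib G_def N algebra_simps)
  have "(\<Sum>i<Suc n. (((\<lambda>i\<in>{..<n}. u + \<gamma> i)(n := u)) i - \<mu>)\<^sup>2)
      = (\<Sum>i<n. (\<gamma> i)\<^sup>2 + (2 * v) * \<gamma> i + v\<^sup>2) + v\<^sup>2"
    by (simp add: v_def power2_eq_square algebra_simps)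
  also have "\<dots> = (\<Sum>i<n. (\<gamma> i)\<^sup>2) + 2 * v * G + N * v\<^sup>2"
    unfolding sum.distrib sum_distrib_left[symmetric] G_def[symmetric]
    by (simp add: N algebra_simps)
  finally have S2: "(\<Sum>i<Suc n. (((\<lambda>i\<in>{..<n}. u + \<gamma> i)(n := u)) i - \<mu>)\<^sup>2)
      = (\<Sum>i<n. (\<gamma> i)\<^sup>2) + 2 * v * G + N * v\<^sup>2" .
  have "u - (\<mu> - G / N) = v + G / N" by (simp add: v_def)
  then show ?thesis
    unfolding S1 S2 using N(1) by (simp add: field_simps power2_eq_square)
qed

lemma nn_integral_normal_density:
  "0 < s \<Longrightarrow> (\<integral>\<^sup>+x. ennreal (normal_density m s x) \<partial>lborel) = 1"
  using prob_space.emeasure_space_1[OF prob_space_normal_density[of s m]]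
  by (simp add: emeasure_density)

text \<open>The centred Gaussian density with covariance \<open>s\<^sup>2 (I + J)\<close>, which is
  the covariance of the differences of independent log-strengths of variance
  \<open>s\<^sup>2\<close>. The inverse of \<open>I + J\<close> is \<open>I - J / (n + 1)\<close>
  and its determinant is \<open>n + 1\<close>.\<close>

definition gaussian_gamma_density :: "nat \<Rightarrow> real \<Rightarrow> (nat \<Rightarrow> real) \<Rightarrow> real" where
  "gaussian_gamma_density n s \<gamma> =
    exp (- ((\<Sum>i<n. (\<gamma> i)\<^sup>2) - (\<Sum>i<n. \<gamma> i)\<^sup>2 / real (Suc n)) / (2 * s\<^sup>2))
      / (sqrt (2 * pi * s\<^sup>2) ^ n * sqrt (real (Suc n)))"

text \<open>Parametrized by the precision matrix \<open>(I - \<kappa> J) / s\<^sup>2\<close>, which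
  is positive definite when \<open>\<kappa> * t < 1\<close>; the case
  \<open>\<mu> = \<kappa> = 0\<close> is the independent prior.\<close>

definition exchangeable_gaussian_density :: "nat \<Rightarrow> real \<Rightarrow> real \<Rightarrow> real \<Rightarrow> (nat \<Rightarrow> real) \<Rightarrow> real" where
  "exchangeable_gaussian_density t \<mu> \<kappa> s l =
    sqrt (1 - \<kappa> * real t) / sqrt (2 * pi * s\<^sup>2) ^ t
      * exp (- ((\<Sum>i<t. (l i - \<mu>)\<^sup>2) - \<kappa> * (\<Sum>i<t. l i - \<mu>)\<^sup>2) / (2 * s\<^sup>2))"

text \<open>Splits the joint density into a marginal for \<open>\<gamma>\<close> and a conditional
  for the last log-strength. The factor \<open>sqrt (1 - \<kappa> N)\<close> goes into the
  normalization of the conditional, so the marginal is free of \<open>\<mu>\<close> and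
  \<open>\<kappa>\<close>.\<close>

lemma exchangeable_gaussian_density_factor:
  fixes \<gamma> :: "nat \<Rightarrow> real"
  assumes s: "0 < s" and \<kappa>: "\<kappa> * real (Suc n) < 1"
  shows "exchangeable_gaussian_density (Suc n) \<mu> \<kappa> s ((\<lambda>i\<in>{..<n}. u + \<gamma> i)(n := u))
    = gaussian_gamma_density n s \<gamma> * normal_density (\<mu> - (\<Sum>i<n. \<gamma> i) / real (Suc n))
        (s / sqrt (real (Suc n) * (1 - \<kappa> * real (Suc n)))) u"
proof -
  define N where "N = real (Suc n)"
  define p where "p = 1 - \<kappa> * N"
  define c where "c = sqrt (2 * pi * s\<^sup>2)"
  define m where "m = \<mu> - (\<Sum>i<n. \<gamma> i) / N"
  define R where "R = (\<Sum>i<n. (\<gamma> i)\<^sup>2) - (\<Sum>i<n. \<gamma> i)\<^sup>2 / N"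
  have pos: "0 < N" "0 < p" "0 < c"
    using s \<kappa> by (simp_all add: N_def p_def c_def)
  \<comment> \<open>Comparing \<open>N * p * (u - m)\<^sup>2 / (2 * s\<^sup>2)\<close> with a normal
    exponent shows that \<open>s\<^sup>2 / (N * p)\<close> is the conditional variance of
    \<open>u\<close>.\<close>
  have tau: "(s / sqrt (N * p))\<^sup>2 = s\<^sup>2 / (N * p)"
    using pos by (simp add: power_divide)
  have sq: "sqrt (2 * pi * (s\<^sup>2 / (N * p))) = c / (sqrt N * sqrt p)"
    by (simp add: c_def real_sqrt_divide real_sqrt_mult)
  have "exchangeable_gaussian_density (Suc n) \<mu> \<kappa> s ((\<lambda>i\<in>{..<n}. u + \<gamma> i)(n := u))
      = sqrt p / c ^ Suc n * exp (- (R + N * p * (u - m)\<^sup>2) / (2 * s\<^sup>2))"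
    unfolding exchangeable_gaussian_density_def complete_square_last_strength
    by (simp only: N_def p_def c_def m_def R_def)
  also have "exp (- (R + N * p * (u - m)\<^sup>2) / (2 * s\<^sup>2))
      = exp (- R / (2 * s\<^sup>2)) * exp (- (u - m)\<^sup>2 / (2 * (s\<^sup>2 / (N * p))))"
    unfolding exp_add[symmetric] using pos s by (simp add: field_simps)
  also have "sqrt p / c ^ Suc n * (exp (- R / (2 * s\<^sup>2)) * exp (- (u - m)\<^sup>2 / (2 * (s\<^sup>2 / (N * p)))))
      = exp (- R / (2 * s\<^sup>2)) / (c ^ n * sqrt N)
        * (1 / (c / (sqrt N * sqrt p)) * exp (- (u - m)\<^sup>2 / (2 * (s\<^sup>2 / (N * p)))))"
    using pos by (simp add: field_simps)
  also have "\<dots> = gaussian_gamma_density n s \<gamma> * normal_density m (s / sqrt (N * p)) u"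
    unfolding gaussian_gamma_density_def normal_density_def tau sq
    by (simp only: N_def c_def R_def)
  finally show ?thesis by (simp only: m_def N_def p_def)
qed

lemma exchangeable_gaussian_density_measurable [measurable]:
  "exchangeable_gaussian_density t \<mu> \<kappa> s \<in> borel_measurable (logstrength_space t)"
  unfolding exchangeable_gaussian_density_def logstrength_space_def by measurable

lemma quadratic_form_scalar_plus_const:
  fixes y :: "nat \<Rightarrow> real"
  shows "(\<Sum>i<t. \<Sum>j<t. y i * ((if i = j then a else 0) + b) * y j)
    = a * (\<Sum>i<t. (y i)\<^sup>2) + b * (\<Sum>i<t. y i)\<^sup>2"
proof -
  have "(\<Sum>i<t. \<Sum>j<t. y i * ((if i = j then a else 0) + b) * y j)
      = (\<Sum>i<t. (\<Sum>j<t. if j = i then a * (y i)\<^sup>2 else 0) + b * (\<Sum>j<t. y i * y j))"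
    unfolding sum_distrib_left sum.distrib[symmetric]
    by (intro sum.cong) (auto simp: power2_eq_square algebra_simps)
  also have "\<dots> = a * (\<Sum>i<t. (y i)\<^sup>2) + b * (\<Sum>i<t. y i)\<^sup>2"
    by (simp add: sum.distrib sum_distrib_left[symmetric] power2_eq_square sum_product)
  finally show ?thesis .
qed

text \<open>The conditional normal factor integrates to 1 over \<open>u\<close>. That the result
  depends on \<open>s\<close> alone is what makes all these priors equivalent.\<close>

lemma induced_density_exchangeable_gaussian:
  assumes s: "0 < s" and \<kappa>: "\<kappa> * real (Suc n) < 1"
  shows "induced_density (Suc n)
    (density (logstrength_space (Suc n)) (\<lambda>l. ennreal (exchangeable_gaussian_density (Suc n) \<mu> \<kappa> s l)))
    (\<lambda>\<gamma>. ennreal (gaussian_gamma_density n s \<gamma>))"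
proof -
  have "(\<integral>\<^sup>+u. ennreal (exchangeable_gaussian_density (Suc n) \<mu> \<kappa> s ((\<lambda>i\<in>{..<n}. u + \<gamma> i)(n := u))) \<partial>lborel)
      = ennreal (gaussian_gamma_density n s \<gamma>)" for \<gamma> :: "nat \<Rightarrow> real"
  proof -
    have nonneg: "0 \<le> gaussian_gamma_density n s \<gamma>"
      by (simp add: gaussian_gamma_density_def)
    have "0 < s / sqrt (real (Suc n) * (1 - \<kappa> * real (Suc n)))"
      using s \<kappa> by simp
    then show ?thesis
      unfolding exchangeable_gaussian_density_factor[OF s \<kappa>]
      by (simp add: ennreal_mult nonneg nn_integral_cmult nn_integral_normal_density del: of_nat_Suc)
  qed
  then show ?thesis
    using induced_density_density[of "\<lambda>l. ennreal (exchangeable_gaussian_density (Suc n) \<mu> \<kappa> s l)" n]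
    by simp
qed

section \<open>The multivariate normal density in precision form\<close>

lemma exchangeable_cov_eq:
  "exchangeable_cov t \<sigma> \<rho> = scalar_plus_const_mat t ((1 - \<rho>) * \<sigma>\<^sup>2) (\<rho> * \<sigma>\<^sup>2)"
  unfolding exchangeable_cov_def scalar_plus_const_mat_def
  by (intro eq_matI) (auto simp: algebra_simps)

text \<open>With \<open>v = (1 - \<rho>) \<sigma>\<^sup>2\<close>, the inverse covariance is sought
  as \<open>(I - \<kappa> J) / v\<close>; vanishing of the \<open>J\<close>-coefficient in its
  product with the covariance forces \<open>\<kappa> = \<rho> / (1 + n \<rho>)\<close>.\<close>

lemma multivariate_normal_density_exchangeable_cov:
  assumes \<sigma>: "0 < \<sigma>\<^sup>2" and \<rho>: "\<rho> < 1" "0 < 1 + real n * \<rho>"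
  shows "multivariate_normal_density (Suc n) (\<lambda>_. \<mu>) (exchangeable_cov (Suc n) \<sigma> \<rho>) l
    = exchangeable_gaussian_density (Suc n) \<mu> (\<rho> / (1 + real n * \<rho>)) (sqrt ((1 - \<rho>) * \<sigma>\<^sup>2)) l"
proof -
  define D where "D = 1 + real n * \<rho>"
  define \<kappa> where "\<kappa> = \<rho> / D"
  define v where "v = (1 - \<rho>) * \<sigma>\<^sup>2"
  define q where "q = 1 - \<rho>"
  define w where "w = \<sigma>\<^sup>2"
  have pos: "0 < D" "0 < v" "0 < q" "0 < w" using \<sigma> \<rho> by (simp_all add: D_def v_def q_def w_def)
  \<comment> \<open>Used twice: in the cancellation \<open>off\<close> and in the normalizing
    constant.\<close>
  have p: "1 - \<kappa> * real (Suc n) = q / D"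
    using pos by (simp add: \<kappa>_def q_def field_simps) (simp add: D_def algebra_simps)
  let ?B = "scalar_plus_const_mat (Suc n) (1 / v) (- \<kappa> / v)"
  have S: "exchangeable_cov (Suc n) \<sigma> \<rho> = scalar_plus_const_mat (Suc n) v (\<rho> * w)"
    by (simp add: exchangeable_cov_eq v_def w_def)
  have off: "v * (- \<kappa> / v) + (\<rho> * w) * (1 / v) + real (Suc n) * (\<rho> * w) * (- \<kappa> / v) = 0"
  proof -
    have vq: "v = q * w" by (simp add: v_def q_def w_def)
    have "v * (- \<kappa> / v) + (\<rho> * w) * (1 / v) + real (Suc n) * (\<rho> * w) * (- \<kappa> / v)
        = - \<kappa> + \<rho> / q * (1 - \<kappa> * real (Suc n))"
      using pos by (simp add: vq field_simps)
    also have "\<dots> = 0"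
      unfolding p using pos by (simp add: \<kappa>_def)
    finally show ?thesis .
  qed
  have one: "scalar_plus_const_mat (Suc n) 1 0 = (1\<^sub>m (Suc n) :: real mat)"
    by (intro eq_matI) (auto simp: scalar_plus_const_mat_def)
  have off': "(1 / v) * (\<rho> * w) + (- \<kappa> / v) * v + real (Suc n) * (- \<kappa> / v) * (\<rho> * w) = 0"
    using off by (simp add: algebra_simps)
  have SB: "scalar_plus_const_mat (Suc n) v (\<rho> * w) * ?B = 1\<^sub>m (Suc n)"
    unfolding scalar_plus_const_mat_mult off using pos by (simp add: one)
  have BS: "?B * scalar_plus_const_mat (Suc n) v (\<rho> * w) = 1\<^sub>m (Suc n)"
    unfolding scalar_plus_const_mat_mult off' using pos by (simp add: one)
  have inv: "mat_inverse (exchangeable_cov (Suc n) \<sigma> \<rho>) = Some ?B"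
    unfolding S by (rule mat_inverse_unique[OF _ _ SB BS]) simp_all
  have "(\<Sum>i<Suc n. \<Sum>j<Suc n. (l i - \<mu>) * ?B $$ (i, j) * (l j - \<mu>))
      = (\<Sum>i<Suc n. \<Sum>j<Suc n. (l i - \<mu>) * ((if i = j then 1 / v else 0) + (- \<kappa> / v)) * (l j - \<mu>))"
    by (intro sum.cong refl) (simp add: scalar_plus_const_mat_def)
  also have "\<dots> = 1 / v * (\<Sum>i<Suc n. (l i - \<mu>)\<^sup>2) + (- \<kappa> / v) * (\<Sum>i<Suc n. l i - \<mu>)\<^sup>2"
    by (rule quadratic_form_scalar_plus_const)
  also have "\<dots> = ((\<Sum>i<Suc n. (l i - \<mu>)\<^sup>2) - \<kappa> * (\<Sum>i<Suc n. l i - \<mu>)\<^sup>2) / v"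
    by (simp add: diff_divide_distrib del: sum.lessThan_Suc)
  finally have Q: "(\<Sum>i<Suc n. \<Sum>j<Suc n. (l i - \<mu>) * ?B $$ (i, j) * (l j - \<mu>))
      = ((\<Sum>i<Suc n. (l i - \<mu>)\<^sup>2) - \<kappa> * (\<Sum>i<Suc n. l i - \<mu>)\<^sup>2) / v" .
  have "Determinant.det (exchangeable_cov (Suc n) \<sigma> \<rho>) = v ^ n * (v + real (Suc n) * (\<rho> * w))"
    unfolding S by (rule det_scalar_plus_const_mat)
  also have "v + real (Suc n) * (\<rho> * w) = w * D"
    by (simp add: v_def w_def D_def algebra_simps)
  \<comment> \<open>Brings the determinant to the form
    \<open>v ^ (n + 1) / (1 - \<kappa> (n + 1))\<close>, matching the prefactor of
    \<open>exchangeable_gaussian_density\<close>.\<close>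
  also have "w * D = v / (q / D)"
    using pos by (simp add: v_def w_def q_def)
  finally have "(2 * pi) ^ Suc n * Determinant.det (exchangeable_cov (Suc n) \<sigma> \<rho>)
      = (2 * pi * v) ^ Suc n / (q / D)"
    by (simp add: power_mult_distrib)
  then have den: "sqrt ((2 * pi) ^ Suc n * Determinant.det (exchangeable_cov (Suc n) \<sigma> \<rho>))
      = sqrt (2 * pi * v) ^ Suc n / sqrt (q / D)"
    by (simp only: real_sqrt_divide real_sqrt_power)
  have sv: "(sqrt v)\<^sup>2 = v" using pos by simp
  have arrange: "exp (- (x / v) / 2) / (c / d) = d / c * exp (- x / (2 * v))" for x c d :: real
    by (simp add: mult.commute)
  show ?thesis
    unfolding multivariate_normal_density_def exchangeable_gaussian_density_def inv option.sel Q den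
      D_def[symmetric] \<kappa>_def[symmetric] v_def[symmetric] sv p
    by (rule arrange)
qed

section \<open>Symmetries of the independent Gaussian prior\<close>

lemma independent_gaussian_prior_eq_density:
  assumes s: "0 < s"
  shows "independent_gaussian_prior t s
    = density (logstrength_space t) (\<lambda>l. ennreal (exchangeable_gaussian_density t 0 0 s l))"
proof -
  have "prob_space (density lborel (\<lambda>x. ennreal (normal_density 0 s x)))"
    using s by (rule prob_space_normal_density)
  then have "sigma_finite_measure (density lborel (\<lambda>x. ennreal (normal_density 0 s x)))"
    by (rule prob_space_imp_sigma_finite)
  then have "independent_gaussian_prior t s
      = density (logstrength_space t) (\<lambda>l. \<Prod>i<t. ennreal (normal_density 0 s (l i)))"
    unfolding independent_gaussian_prior_def logstrength_space_def
    by (intro PiM_density) (auto intro: sigma_finite_lborel)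
  also have "(\<lambda>l. \<Prod>i<t. ennreal (normal_density 0 s (l i)))
      = (\<lambda>l. ennreal (exchangeable_gaussian_density t 0 0 s l))"
    by (simp add: fun_eq_iff prod_ennreal normal_density_def exchangeable_gaussian_density_def
        prod.distrib exp_sum[symmetric] sum_negf sum_divide_distrib power_divide prod_dividef)
  finally show ?thesis .
qed

text \<open>Only \<open>\<sigma>\<^sup>2\<close> enters \<open>gaussian_prior\<close>, so
  \<open>\<sigma>\<close> may be negative and the standard deviation is its absolute value.\<close>

lemma gaussian_prior_eq_independent:
  assumes "\<sigma> \<noteq> 0"
  shows "gaussian_prior \<sigma> t = independent_gaussian_prior t \<bar>\<sigma>\<bar>"
proof -
  have "(2 * pi * \<sigma>\<^sup>2) powr (real t / 2) = sqrt (2 * pi * \<sigma>\<^sup>2) ^ t"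
    using assms by (simp add: powr_half_sqrt[symmetric] powr_power)
  then show ?thesis
    using assms
    by (simp add: independent_gaussian_prior_eq_density gaussian_prior_def
        exchangeable_gaussian_density_def sum_divide_distrib)
qed

lemma sets_independent_gaussian_prior:
  "sets (independent_gaussian_prior t s) = sets (logstrength_space t)"
  unfolding independent_gaussian_prior_def logstrength_space_def by (simp cong: sets_PiM_cong)

text \<open>On extensional vectors the swap is a reindexing by a transposition of
  \<open>{..<t}\<close>, and all factors of the product are equal.\<close>

lemma distr_independent_gaussian_prior_swap:
  assumes s: "0 < s" and ij: "i < t" "j < t"
  shows "distr (independent_gaussian_prior t s) (logstrength_space t) (swap_teams i j)
    = independent_gaussian_prior t s"
proof -
  let ?N = "density lborel (\<lambda>x. ennreal (normal_density 0 s x))"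
  let ?P = "\<Pi>\<^sub>M i\<in>{..<t}. ?N"
  let ?f = "Transposition.transpose i j"
  have "distr ?P (logstrength_space t) (swap_teams i j) = distr ?P ?P (\<lambda>l. \<lambda>k\<in>{..<t}. l (?f k))"
  proof (rule distr_cong)
    show "sets (logstrength_space t) = sets ?P"
      using sets_independent_gaussian_prior[of t s] by (simp add: independent_gaussian_prior_def)
    fix l assume "l \<in> space ?P"
    then show "swap_teams i j l = (\<lambda>k\<in>{..<t}. l (?f k))"
      using ij by (auto simp: swap_teams_def fun_eq_iff Transposition.transpose_def space_PiM PiE_iff extensional_def)
  qed simp
  also have "\<dots> = ?P"
    by (rule distr_PiM_reindex)
       (use s ij in \<open>auto simp: prob_space_normal_density Transposition.transpose_def inj_on_def split: if_splits\<close>)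
  finally show ?thesis by (simp add: independent_gaussian_prior_def)
qed

lemma distr_independent_gaussian_prior_invert:
  assumes s: "0 < s"
  shows "distr (independent_gaussian_prior t s) (logstrength_space t) (invert_strengths t)
    = independent_gaussian_prior t s"
proof -
  let ?N = "density lborel (\<lambda>x. ennreal (normal_density 0 s x))"
  let ?P = "\<Pi>\<^sub>M i\<in>{..<t}. ?N"
  have sf: "sigma_finite_measure ?N"
    using s by (intro prob_space_imp_sigma_finite prob_space_normal_density)
  have "distr ?N ?N uminus = ?N"
  proof -
    \<comment> \<open>Evenness of the centred normal density lets it be written as a pullback along
      \<open>uminus\<close>, the form that \<open>density_distr\<close> expects.\<close>
    have "distr ?N ?N uminus = distr (density lborel (\<lambda>x. ennreal (normal_density 0 s (- x)))) lborel uminus"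
      by (rule distr_cong) (simp_all add: normal_density_def)
    also have "\<dots> = density (distr lborel lborel uminus) (\<lambda>x. ennreal (normal_density 0 s x))"
      by (rule density_distr[symmetric]) auto
    also have "distr lborel lborel uminus = (lborel :: real measure)"
      using lborel_distr_uminus by (simp cong: distr_cong)
    finally show ?thesis .
  qed
  then have "distr ?P ?P (\<lambda>x. \<lambda>i\<in>{..<t}. - x i) = ?P"
    using sf by (intro distr_PiM_componentwise) auto
  moreover have "distr ?P (logstrength_space t) (invert_strengths t) = distr ?P ?P (\<lambda>x. \<lambda>i\<in>{..<t}. - x i)"
    using sets_independent_gaussian_prior[of t s]
    by (intro distr_cong) (simp_all add: independent_gaussian_prior_def invert_strengths_def)
  ultimately show ?thesis by (simp add: independent_gaussian_prior_def)
qed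

text \<open>The forgotten coordinates are probability factors and contribute total mass 1.\<close>

lemma distr_independent_gaussian_prior_restrict:
  assumes s: "0 < s" and "m \<le> t"
  shows "distr (independent_gaussian_prior t s) (logstrength_space m) (\<lambda>l. restrict l {..<m})
    = independent_gaussian_prior m s"
proof -
  let ?N = "density lborel (\<lambda>x. ennreal (normal_density 0 s x))"
  interpret product_prob_space "\<lambda>_. ?N" "{..<t}"
    using s by (intro product_prob_spaceI prob_space_normal_density)
  have "distr (Pi\<^sub>M {..<t} (\<lambda>_. ?N)) (logstrength_space m) (\<lambda>l. restrict l {..<m})
      = distr (Pi\<^sub>M {..<t} (\<lambda>_. ?N)) (Pi\<^sub>M {..<m} (\<lambda>_. ?N)) (\<lambda>l. restrict l {..<m})"
    using sets_independent_gaussian_prior[of m s]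
    by (intro distr_cong) (simp_all add: independent_gaussian_prior_def)
  also have "\<dots> = Pi\<^sub>M {..<m} (\<lambda>_. ?N)"
    using \<open>m \<le> t\<close> by (intro distr_restrict[symmetric]) auto
  finally show ?thesis by (simp add: independent_gaussian_prior_def)
qed

section \<open>Reflexivity of equivalence, normalizability and the conclusion\<close>

lemma induced_density_independent_gaussian:
  "0 < s \<Longrightarrow> induced_density (Suc n) (independent_gaussian_prior (Suc n) s)
    (\<lambda>\<gamma>. ennreal (gaussian_gamma_density n s \<gamma>))"
  using induced_density_exchangeable_gaussian[of s 0 n 0]
  by (simp add: independent_gaussian_prior_eq_density)

text \<open>Not automatic, since \<open>prior_equiv\<close> demands that a density of
  \<open>\<gamma>\<close> exist. It yields each invariance once the transformation is known to fix
  the measure.\<close>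

lemma prior_equiv_refl_independent_gaussian:
  assumes "0 < s" "0 < t"
  shows "prior_equiv t (independent_gaussian_prior t s) (independent_gaussian_prior t s)"
  using induced_density_independent_gaussian[OF \<open>0 < s\<close>, of "t - 1"] \<open>0 < t\<close>
  unfolding prior_equiv_def by auto

text \<open>The image of a probability measure has mass 1, so the constant \<open>c = 1\<close>
  works.\<close>

lemma normalizable_prob_space:
  assumes "prob_space P" and f: "induced_density t P f"
  shows "normalizable t P"
proof -
  have d: "distributed P (gamma_space t) (gamma_of t) f"
    using f by (simp add: induced_density_def)
  have "prob_space (distr P (gamma_space t) (gamma_of t))"
    using assms(1) distributed_measurable[OF d] by (rule prob_space.prob_space_distr)
  then have "emeasure (density (gamma_space t) f) (space (gamma_space t)) = 1"
    using prob_space.emeasure_space_1 distributed_distr_eq_density[OF d] by fastforce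
  then have "(\<integral>\<^sup>+\<gamma>. f \<gamma> \<partial>gamma_space t) = 1"
    using distributed_borel_measurable[OF d] by (simp add: emeasure_density cong: nn_integral_cong)
  then show ?thesis
    unfolding normalizable_def using f by (intro exI[of _ f] conjI exI[of _ 1]) auto
qed

theorem mainTheorem7:
  shows "(\<forall>(t::nat) (\<mu>::real) (\<sigma>::real) (\<rho>::real).
            2 \<le> t \<and> 0 < \<sigma>\<^sup>2 \<and> - 1 / (real t - 1) < \<rho> \<and> \<rho> < 1 \<longrightarrow>
            prior_equiv t (exchangeable_gaussian_prior t \<mu> \<sigma> \<rho>)
              (independent_gaussian_prior t (sqrt ((1 - \<rho>) * \<sigma>\<^sup>2))))
       \<and> (\<forall>\<sigma>::real. 0 < \<sigma>\<^sup>2 \<longrightarrow>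
            (\<forall>t\<ge>2. team_interchange_invariant t (gaussian_prior \<sigma> t)
                 \<and> win_loss_invariant t (gaussian_prior \<sigma> t)
                 \<and> normalizable t (gaussian_prior \<sigma> t))
            \<and> team_elimination_invariant (gaussian_prior \<sigma>))"
proof (intro conjI allI impI)
  fix t :: nat and \<mu> \<sigma> \<rho> :: real
  assume a: "2 \<le> t \<and> 0 < \<sigma>\<^sup>2 \<and> - 1 / (real t - 1) < \<rho> \<and> \<rho> < 1"
  obtain n where t: "t = Suc n" and n: "1 \<le> n"
    using a by (cases t) auto
  \<comment> \<open>The lower bound on \<open>\<rho>\<close>, multiplied by
    \<open>n = t - 1 > 0\<close>.\<close>
  have D: "0 < 1 + real n * \<rho>"
    using a n by (simp add: t field_simps)
  let ?s = "sqrt ((1 - \<rho>) * \<sigma>\<^sup>2)"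
  have s: "0 < ?s" using a by simp
  \<comment> \<open>Multiplying by the positive denominator reduces this to
    \<open>\<rho> < 1\<close>.\<close>
  have "\<rho> / (1 + real n * \<rho>) * real (Suc n) < 1"
    using D a by (simp add: field_simps)
  then have "induced_density t (exchangeable_gaussian_prior t \<mu> \<sigma> \<rho>)
      (\<lambda>\<gamma>. ennreal (gaussian_gamma_density n ?s \<gamma>))"
    using induced_density_exchangeable_gaussian[OF s] a D
    by (simp only: t exchangeable_gaussian_prior_def multivariate_normal_density_exchangeable_cov)
  then show "prior_equiv t (exchangeable_gaussian_prior t \<mu> \<sigma> \<rho>) (independent_gaussian_prior t ?s)"
    using induced_density_independent_gaussian[OF s, of n] unfolding prior_equiv_def t by auto
next
  fix \<sigma> :: real and t :: nat
  assume \<sigma>: "0 < \<sigma>\<^sup>2" and t: "2 \<le> t"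
  have s: "0 < \<bar>\<sigma>\<bar>" and eq: "gaussian_prior \<sigma> t = independent_gaussian_prior t \<bar>\<sigma>\<bar>"
    using \<sigma> gaussian_prior_eq_independent by auto
  have refl: "prior_equiv t (gaussian_prior \<sigma> t) (gaussian_prior \<sigma> t)"
    using prior_equiv_refl_independent_gaussian[OF s] t by (simp add: eq)
  show "team_interchange_invariant t (gaussian_prior \<sigma> t)"
    unfolding team_interchange_invariant_def
    using refl by (simp add: eq distr_independent_gaussian_prior_swap[OF s])
  show "win_loss_invariant t (gaussian_prior \<sigma> t)"
    unfolding win_loss_invariant_def
    using refl by (simp add: eq distr_independent_gaussian_prior_invert[OF s])
  have "prob_space (gaussian_prior \<sigma> t)"
    unfolding eq independent_gaussian_prior_def
    by (intro prob_space_PiM prob_space_normal_density s)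
  then show "normalizable t (gaussian_prior \<sigma> t)"
    using refl normalizable_prob_space by (auto simp: prior_equiv_def)
next
  fix \<sigma> :: real
  assume \<sigma>: "0 < \<sigma>\<^sup>2"
  have s: "0 < \<bar>\<sigma>\<bar>" and eq: "gaussian_prior \<sigma> t = independent_gaussian_prior t \<bar>\<sigma>\<bar>" for t
    using \<sigma> gaussian_prior_eq_independent by auto
  show "team_elimination_invariant (gaussian_prior \<sigma>)"
    unfolding team_elimination_invariant_def
    by (simp add: eq distr_independent_gaussian_prior_restrict[OF s] prior_equiv_refl_independent_gaussian[OF s])
qed

end
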